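(* Let $F$ be a field, let $K$ be a finite simplicial complex with totally ordered vertices, and let $n\ge3$. Suppose that, for every edge $b$ of $K$, the link $\mathrm{lk}(b,K)$ has trivial $(n-2)$-th simplicial cohomology group: $$H^{n-2}(\mathrm{lk}(b,K),F)=0.$$ Then the cohomology map $$f^{(n)}\colon\ H^n_{\mathrm{hex}}\to H^n(K,F)$$ induced in dimension $n$ by the chain map $f$ determined by a permitted coloring of $K$ depends only on the coloring homology class of the permitted coloring, i.e. on its class in $H_{\mathrm{col}}(K,F)=V_K/V_K^{(0)}$.
   Context: All simplicial complexes are finite with totally ordered vertices; subcomplexes inherit the order. Writing a simplex as $i_1i_2\dots i_m$ means its vertices are listed in increasing order. A pentachoron is a 4-simplex. $F$ is a fixed field. The link $\mathrm{lk}(A,K)$ of a simplex $A$ in $K$ consists of all simplices $B$ such that the join $A\star B$ is also a simplex of $K$. Colorings. A coloring of a simplicial complex $K$ is a map assigning to every tetrahedron (3-simplex) $t$ of $K$ a color $\binom{x_t}{y_t}\in F^2$. Colorings form a vector space over $F$. Edge functionals. Let $u=i_1i_2i_3i_4i_5$ be a pentachoron and $b$ one of its ten edges. The linear functional $\phi_b$ on the colorings of $u$ is the sum, over the three tetrahedra $t\subset u$ containing $b$, of the following contributions. If $t=k_1k_2k_3k_4$ (with $k_1<k_2<k_3<k_4$) is the face of $u$ opposite the vertex $i_m$, put $\varepsilon=(-1)^{m+1}$. The contribution of $t$ is: $\varepsilon y_t$ for $b=k_1k_2$; $\varepsilon(x_t-y_t)$ for $b=k_1k_3$; $-\varepsilon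 x_t$ for $b=k_1k_4$; $-\varepsilon x_t$ for $b=k_2k_3$; $\varepsilon(x_t+y_t)$ for $b=k_2k_4$; $-\varepsilon y_t$ for $b=k_3k_4$. Permitted colorings. A coloring of a pentachoron $u$ is permitted if $\phi_b$ vanishes on it for all ten edges $b\subset u$. A coloring of a complex $K$ is permitted if its restriction to every pentachoron of $K$ is permitted (in particular, all colorings of a single tetrahedron are permitted). Permitted colorings of $K$ form the vector space $V_K$. Edge vectors. For an edge $b$ of $K$, the edge vector $\psi_b$ is the coloring of $K$ that is zero on all tetrahedra not containing $b$, and on a tetrahedron $t=k_1k_2k_3k_4\supset b$ (with $k_1<k_2<k_3<k_4$) has the color $\binom{1}{0}$ if $b=k_1k_2$; $\binom{-1}{1}$ if $b=k_1k_3$; $\binom{0}{-1}$ if $b=k_1k_4$; $\binom{0}{-1}$ if $b=k_2k_3$; $\binom{1}{1}$ if $b=k_2k_4$; $\binom{-1}{0}$ if $b=k_3k_4$. Edge vectors are permitted colorings. Linear combinations of edge vectors are called edge-generated colorings; they form a subspace $V_K^{(0)}\subset V_K$. Coloring homology is $H_{\mathrm{col}}(K,F)=V_K/V_K^{(0)}$. Hexagon cochains. Let $\Delta^n=1\dots(n{+}1)$ be the standard $n$-simplex. For $n\ge3$, $C^n_{\mathrm{hex}}$ is the linear space of all polynomials (with coefficients in $F$) on the linear space $V_{\Delta^n}$. The coboundary of $\mathfrak c\in C^n_{\mathrm{hex}}$ is the polynomial on $V_{\Delta^{n+1}}$ $$\delta\mathfrak c=\sum_{k=1}^{n+2}(-1)^{k+1}\,\mathfrak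 c_{1\dots\widehat k\dots(n+2)},$$ where $\mathfrak c_{1\dots\widehat k\dots(n+2)}$ is $\mathfrak c$ applied to the restriction of the coloring to the face $1\dots\widehat k\dots(n+2)$, this face being identified with $\Delta^n$ by the order-preserving bijection of vertices. $H^n_{\mathrm{hex}}$ is the $n$-th cohomology of the complex $0\to C^3_{\mathrm{hex}}\to C^4_{\mathrm{hex}}\to\cdots$. Chain map $f$. $C^n(K,F)$ is the space of $F$-valued simplicial $n$-cochains of $K$, i.e. functions on the $n$-simplices of $K$ (with vertices in increasing order), with the coboundary $(\delta\varphi)(i_1\dots i_{n+2})=\sum_{k=1}^{n+2}(-1)^{k+1}\varphi(i_1\dots\widehat{i_k}\dots i_{n+2})$. Given a permitted coloring of $K$ and $\mathfrak c\in C^n_{\mathrm{hex}}$, the value of the cochain $f_n(\mathfrak c)\in C^n(K,F)$ on an $n$-simplex $\sigma^n\subset K$ is the value of the polynomial $\mathfrak c$ on the permitted coloring of $\Delta^n$ obtained by restricting the given coloring to $\sigma^n$ and transferring it to $\Delta^n$ via the order-preserving bijection of vertices. The maps $f_n$, $n\ge3$, commute with the coboundaries and thus form a chain map $f$, which depends on the chosen permitted coloring and induces maps $f^{(n)}\colon H^n_{\mathrm{hex}}\to H^n(K,F)$. *)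

theory Defs
  imports
    "HOL-Library.Poly_Mapping"
    "HOL-Library.Product_Plus"
    "HOL-Library.Function_Algebras"
begin

section \<open>Ordered simplicial complexes and their cohomology\<close>

text \<open>Simplices are nonempty finite vertex sets; the vertex order is that of the vertex type.\<close>

definition simplicial_complex :: "'a set set \<Rightarrow> bool" where
  "simplicial_complex K \<longleftrightarrow>
     finite K \<and> (\<forall>s\<in>K. finite s \<and> s \<noteq> {}) \<and> (\<forall>s\<in>K. \<forall>s'. s' \<subseteq> s \<longrightarrow> s' \<noteq> {} \<longrightarrow> s' \<in> K)"

definition simplices :: "nat \<Rightarrow> 'a set set \<Rightarrow> 'a set set" where
  "simplices n K = {s \<in> K. card s = n + 1}"

definition link :: "'a set \<Rightarrow> 'a set set \<Rightarrow> 'a set set" where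
  "link A K = {B \<in> K. A \<inter> B = {} \<and> A \<union> B \<in> K}"

definition std_simplex :: "nat \<Rightarrow> nat set set" where
  "std_simplex n = {s. s \<subseteq> {1..n+1} \<and> s \<noteq> {}}"

text \<open>\<open>vert s k\<close> is the \<open>k\<close>-th smallest vertex of \<open>s\<close>, counted from 1. As a function of \<open>k\<close> it is
  the order-preserving bijection from \<open>{1..card s}\<close> to \<open>s\<close>.\<close>

definition vert :: "'a::linorder set \<Rightarrow> nat \<Rightarrow> 'a" where
  "vert s k = sorted_list_of_set s ! (k - 1)"

definition face :: "nat \<Rightarrow> 'a::linorder set \<Rightarrow> 'a set" where
  "face k s = s - {vert s k}"

text \<open>Cosets of \<open>B\<close> in \<open>Z\<close>. The zero element of the quotient \<open>Z // coset_rel Z B\<close> is \<open>B\<close> itself.\<close>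

definition coset_rel :: "'v::ab_group_add set \<Rightarrow> 'v set \<Rightarrow> ('v \<times> 'v) set" where
  "coset_rel Z B = {(x, y). x \<in> Z \<and> y \<in> Z \<and> x - y \<in> B}"

text \<open>Functions on the \<open>n\<close>-simplices of \<open>K\<close> are represented by functions on all vertex sets that
  are zero elsewhere; likewise for colorings below.\<close>

definition cochains :: "nat \<Rightarrow> 'a set set \<Rightarrow> ('a set \<Rightarrow> 'f::field) set" where
  "cochains n K = {\<phi>. \<forall>s. s \<notin> simplices n K \<longrightarrow> \<phi> s = 0}"

definition cobd :: "nat \<Rightarrow> 'a::linorder set set \<Rightarrow> ('a set \<Rightarrow> 'f::field) \<Rightarrow> ('a set \<Rightarrow> 'f)" where
  "cobd n K \<phi> = (\<lambda>s. if s \<in> simplices (n+1) K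
                      then (\<Sum>k=1..n+2. (-1)^(k+1) * \<phi> (face k s)) else 0)"

definition cocycles :: "nat \<Rightarrow> 'a::linorder set set \<Rightarrow> ('a set \<Rightarrow> 'f::field) set" where
  "cocycles n K = {\<phi> \<in> cochains n K. cobd n K \<phi> = 0}"

definition coboundaries :: "nat \<Rightarrow> 'a::linorder set set \<Rightarrow> ('a set \<Rightarrow> 'f::field) set" where
  "coboundaries n K = (case n of 0 \<Rightarrow> {0} | Suc m \<Rightarrow> cobd m K ` cochains m K)"

definition cohom_rel ::
    "nat \<Rightarrow> 'a::linorder set set \<Rightarrow> (('a set \<Rightarrow> 'f::field) \<times> ('a set \<Rightarrow> 'f)) set" where
  "cohom_rel n K = coset_rel (cocycles n K) (coboundaries n K)"

definition cohomology :: "nat \<Rightarrow> 'a::linorder set set \<Rightarrow> ('a set \<Rightarrow> 'f::field) set set" where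
  "cohomology n K = cocycles n K // cohom_rel n K"


section \<open>Permitted colorings and coloring homology\<close>

type_synonym ('a, 'f) coloring = "'a set \<Rightarrow> 'f \<times> 'f"

definition colorings :: "'a set set \<Rightarrow> ('a, 'f::field) coloring set" where
  "colorings K = {v. \<forall>t. t \<notin> simplices 3 K \<longrightarrow> v t = 0}"

text \<open>The contribution, up to the sign \<open>\<epsilon>\<close>, of a tetrahedron \<open>t\<close> to \<open>\<phi>\<^sub>b\<close>; it is 0 when \<open>b\<close> is not
  an edge of \<open>t\<close>, so that in \<open>edge_functional\<close> one may sum over all five faces of \<open>u\<close>.\<close>

definition edge_contrib :: "'a::linorder set \<Rightarrow> 'a set \<Rightarrow> 'f \<times> 'f \<Rightarrow> 'f::field" where
  "edge_contrib t b c = (let x = fst c; y = snd c in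
     if b = {vert t 1, vert t 2} then y
     else if b = {vert t 1, vert t 3} then x - y
     else if b = {vert t 1, vert t 4} then - x
     else if b = {vert t 2, vert t 3} then - x
     else if b = {vert t 2, vert t 4} then x + y
     else if b = {vert t 3, vert t 4} then - y
     else 0)"

definition edge_functional :: "'a::linorder set \<Rightarrow> 'a set \<Rightarrow> ('a, 'f::field) coloring \<Rightarrow> 'f" where
  "edge_functional u b v = (\<Sum>m=1..5. (-1)^(m+1) * edge_contrib (face m u) b (v (face m u)))"

definition permitted :: "'a::linorder set set \<Rightarrow> ('a, 'f::field) coloring set" where
  "permitted K = {v \<in> colorings K.
     \<forall>u\<in>simplices 4 K. \<forall>b. b \<subseteq> u \<and> card b = 2 \<longrightarrow> edge_functional u b v = 0}"

definition edge_color :: "'a::linorder set \<Rightarrow> 'a set \<Rightarrow> 'f::field \<times> 'f" where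
  "edge_color t b =
    (if b = {vert t 1, vert t 2} then (1, 0)
     else if b = {vert t 1, vert t 3} then (-1, 1)
     else if b = {vert t 1, vert t 4} then (0, -1)
     else if b = {vert t 2, vert t 3} then (0, -1)
     else if b = {vert t 2, vert t 4} then (1, 1)
     else if b = {vert t 3, vert t 4} then (-1, 0)
     else (0, 0))"

definition edge_vector :: "'a::linorder set set \<Rightarrow> 'a set \<Rightarrow> ('a, 'f::field) coloring" where
  "edge_vector K b = (\<lambda>t. if t \<in> simplices 3 K then edge_color t b else 0)"

definition edge_generated :: "'a::linorder set set \<Rightarrow> ('a, 'f::field) coloring set" where
  "edge_generated K = {v. \<exists>a. v = (\<lambda>t. \<Sum>b\<in>simplices 1 K.
     (a b * fst (edge_vector K b t), a b * snd (edge_vector K b t)))}"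

definition coloring_homology :: "'a::linorder set set \<Rightarrow> ('a, 'f::field) coloring set set" where
  "coloring_homology K = permitted K // coset_rel (permitted K) (edge_generated K)"


section \<open>Polynomials on permitted colorings of the standard simplex\<close>

text \<open>A polynomial on a linear space \<open>V\<close> is a formal polynomial, i.e. an element of the symmetric
  algebra of the dual of \<open>V\<close>; over a finite field this is finer than a polynomial function. For
  \<open>V = permitted (std_simplex n)\<close>, a subspace of all colorings, this algebra is presented as
  \<open>hex_poly n\<close>, the polynomials in the coordinates \<open>CX t\<close>, \<open>CY t\<close> for the tetrahedra \<open>t\<close>, modulo the
  ideal \<open>hex_ideal n\<close> generated by the linear forms that vanish on \<open>V\<close>.\<close>

datatype coord = CX "nat set" | CY "nat set"

fun coord_simplex :: "coord \<Rightarrow> nat set" where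
  "coord_simplex (CX t) = t"
| "coord_simplex (CY t) = t"

fun coord_map :: "(nat \<Rightarrow> nat) \<Rightarrow> coord \<Rightarrow> coord" where
  "coord_map g (CX t) = CX (g ` t)"
| "coord_map g (CY t) = CY (g ` t)"

fun coord_val :: "(nat, 'f::field) coloring \<Rightarrow> coord \<Rightarrow> 'f" where
  "coord_val v (CX t) = fst (v t)"
| "coord_val v (CY t) = snd (v t)"

type_synonym 'f cpoly = "(coord \<Rightarrow>\<^sub>0 nat) \<Rightarrow>\<^sub>0 'f"

definition pconst :: "'f::field \<Rightarrow> 'f cpoly" where
  "pconst a = Poly_Mapping.single 0 a"

definition pvar :: "coord \<Rightarrow> 'f::field cpoly" where
  "pvar z = Poly_Mapping.single (Poly_Mapping.single z 1) 1"

definition psubst :: "('f \<Rightarrow> 'r) \<Rightarrow> (coord \<Rightarrow> 'r) \<Rightarrow> 'f::field cpoly \<Rightarrow> 'r::comm_ring_1" where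
  "psubst h g p = (\<Sum>m\<in>Poly_Mapping.keys p. h (Poly_Mapping.lookup p m) *
     (\<Prod>z\<in>Poly_Mapping.keys m. g z ^ Poly_Mapping.lookup m z))"

definition peval :: "(nat, 'f::field) coloring \<Rightarrow> 'f cpoly \<Rightarrow> 'f" where
  "peval v = psubst (\<lambda>a. a) (coord_val v)"

definition hex_poly :: "nat \<Rightarrow> 'f::field cpoly set" where
  "hex_poly n = {p. \<forall>m\<in>Poly_Mapping.keys p. \<forall>z\<in>Poly_Mapping.keys m.
     coord_simplex z \<in> simplices 3 (std_simplex n)}"

definition hex_linear :: "nat \<Rightarrow> 'f::field cpoly set" where
  "hex_linear n = {l. \<exists>a b.
     l = (\<Sum>t\<in>simplices 3 (std_simplex n). pconst (a t) * pvar (CX t) + pconst (b t) * pvar (CY t)) \<and>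
     (\<forall>v\<in>permitted (std_simplex n). peval v l = 0)}"

definition hex_ideal :: "nat \<Rightarrow> 'f::field cpoly set" where
  "hex_ideal n = {p. \<exists>S q. finite S \<and> S \<subseteq> hex_linear n \<and> (\<forall>l\<in>S. q l \<in> hex_poly n) \<and>
     p = (\<Sum>l\<in>S. q l * l)}"


section \<open>Hexagon cohomology\<close>

text \<open>Restricting a coloring to the face of \<open>std_simplex (n+1)\<close> opposite \<open>k\<close> and transferring it to
  \<open>std_simplex n\<close> acts on polynomials by relabelling the coordinates along \<open>vert ({1..n+2} - {k})\<close>.\<close>

definition hex_cobd :: "nat \<Rightarrow> 'f::field cpoly \<Rightarrow> 'f cpoly" where
  "hex_cobd n c = (\<Sum>k=1..n+2. (-1)^(k+1) *
     psubst pconst (\<lambda>z. pvar (coord_map (vert ({1..n+2} - {k})) z)) c)"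

text \<open>The complex starts in degree 3. All conditions on representatives are modulo \<open>hex_ideal\<close>.\<close>

definition hex_cocycles :: "nat \<Rightarrow> 'f::field cpoly set" where
  "hex_cocycles n = {c \<in> hex_poly n. hex_cobd n c \<in> hex_ideal (n+1)}"

definition hex_coboundaries :: "nat \<Rightarrow> 'f::field cpoly set" where
  "hex_coboundaries n = {d + i | d i.
     d \<in> (if n \<le> 3 then {0} else hex_cobd (n-1) ` hex_poly (n-1)) \<and> i \<in> hex_ideal n}"

definition hex_cohomology :: "nat \<Rightarrow> 'f::field cpoly set set" where
  "hex_cohomology n = hex_cocycles n // coset_rel (hex_cocycles n) (hex_coboundaries n)"


section \<open>The map from hexagon cohomology to simplicial cohomology\<close>

definition transfer_coloring ::
    "nat \<Rightarrow> 'a::linorder set \<Rightarrow> ('a, 'f::field) coloring \<Rightarrow> (nat, 'f) coloring" where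
  "transfer_coloring n s v = (\<lambda>t. if t \<in> simplices 3 (std_simplex n) then v (vert s ` t) else 0)"

definition chain_map ::
    "nat \<Rightarrow> 'a::linorder set set \<Rightarrow> ('a, 'f::field) coloring \<Rightarrow> 'f cpoly \<Rightarrow> ('a set \<Rightarrow> 'f)" where
  "chain_map n K v c = (\<lambda>s. if s \<in> simplices n K then peval (transfer_coloring n s v) c else 0)"

definition cohom_map ::
    "nat \<Rightarrow> 'a::linorder set set \<Rightarrow> ('a, 'f::field) coloring \<Rightarrow> 'f cpoly set \<Rightarrow> ('a set \<Rightarrow> 'f) set" where
  "cohom_map n K v h = (\<Union>c\<in>h. cohom_rel n K `` {chain_map n K v c})"

end

theory Submission
  imports Defs
begin

text \<open>Two homologous permitted colorings differ by a linear combination of edge vectors. Edge vectors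
  are permitted (\<open>edge_vector_permitted\<close>), so one coloring can be turned into the other by adding
  multiples of edge vectors one at a time, without leaving the permitted colorings. It is enough to
  treat one step, from \<open>v\<close> to \<open>w = v + a \<psi>\<^sub>b\<close>.

  Let \<open>c\<close> represent a hexagon cohomology class. The cochains that \<open>c\<close> yields under \<open>v\<close> and under \<open>w\<close>
  are both cocycles (\<open>chain_map_cocycle\<close>), and they agree on every simplex that does not contain \<open>b\<close>,
  because \<open>\<psi>\<^sub>b\<close> vanishes on the tetrahedra of such a simplex. Their difference \<open>g\<close> is thus a cocycle
  of \<open>K\<close> supported on the simplices containing \<open>b\<close>.

  Removing \<open>b\<close> from these simplices identifies them with the simplices of the link of \<open>b\<close>, two
  dimensions lower. Up to signs this carries the coboundary of \<open>K\<close> to that of the link: deleting a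
  vertex of \<open>b\<close> leaves the support, so only deletions of vertices of the link contribute
  (\<open>cobd_star\<close>). Hence \<open>g\<close> comes from a cocycle of degree \<open>n - 2\<close> on the link, which is a coboundary
  by hypothesis. As \<open>n - 2\<close> is positive, it is the coboundary of a cochain of degree \<open>n - 3\<close>, and
  carrying this cochain back to the star of \<open>b\<close> exhibits \<open>g\<close> as a coboundary in \<open>K\<close>
  (\<open>star_cocycle_is_coboundary\<close>).

  The argument applies to each representative \<open>c\<close> separately. So the images of a class under \<open>v\<close> and
  \<open>w\<close>, which are unions over the representatives, agree term by term.\<close>

section \<open>Vertices in increasing order\<close>

lemma vert_in:
  assumes "finite s" "k \<in> {1..card s}"
  shows "vert s k \<in> s"
proof -
  have "sorted_list_of_set s ! (k - 1) \<in> set (sorted_list_of_set s)"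
    using assms by (intro nth_mem) auto
  then show ?thesis using assms by (simp add: vert_def)
qed

lemma vert_less:
  assumes "finite s" "1 \<le> i" "i < j" "j \<le> card s"
  shows "vert s i < vert s j"
  unfolding vert_def using assms
  by (intro sorted_wrt_nth_less[OF strict_sorted_list_of_set]) auto

lemma strict_mono_on_vert: "finite s \<Longrightarrow> strict_mono_on {1..card s} (vert s)"
  by (auto intro!: strict_mono_onI vert_less)

lemma strict_mono_on_vert_subset:
  "finite s \<Longrightarrow> A \<subseteq> {1..card s} \<Longrightarrow> strict_mono_on A (vert s)"
  by (rule monotone_on_subset[OF strict_mono_on_vert])

lemma bij_betw_vert:
  assumes "finite s"
  shows "bij_betw (vert s) {1..card s} s"
proof -
  have inj: "inj_on (vert s) {1..card s}"
    using strict_mono_on_vert[OF assms] by (rule strict_mono_on_imp_inj_on)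
  moreover have "vert s ` {1..card s} = s"
    using assms vert_in[OF assms] card_image[OF inj] by (intro card_subset_eq) auto
  ultimately show ?thesis by (simp add: bij_betw_def)
qed

lemma vert_image:
  assumes "finite s" "strict_mono_on s f" "k \<in> {1..card s}"
  shows "vert (f ` s) k = f (vert s k)"
proof -
  have "sorted_wrt (<) (map f (sorted_list_of_set s))"
    using sorted_wrt_mono_rel[of "sorted_list_of_set s" "(<)" "\<lambda>x y. f x < f y"]
      strict_mono_onD[OF assms(2)] assms(1) strict_sorted_list_of_set[of s]
    by (simp add: sorted_wrt_map)
  then have "sorted_list_of_set (f ` s) = map f (sorted_list_of_set s)"
    using assms(1) by (intro strict_sorted_equal) auto
  moreover have "k - 1 < length (sorted_list_of_set s)" using assms by auto
  ultimately show ?thesis by (simp add: vert_def)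
qed

lemma face_image:
  assumes "finite s" "strict_mono_on s f" "k \<in> {1..card s}"
  shows "face k (f ` s) = f ` face k s"
  using vert_in[OF assms(1,3)] strict_mono_on_imp_inj_on[OF assms(2)]
  by (auto simp: face_def vert_image[OF assms] inj_on_def)

lemma card_less_vert:
  assumes "finite s" "k \<in> {1..card s}"
  shows "card {y \<in> s. y < vert s k} = k - 1"
proof -
  note mono = strict_mono_on_vert[OF assms(1)]
  have "{y \<in> s. y < vert s k} = vert s ` {1..<k}"
  proof (intro equalityI subsetI)
    fix y assume y: "y \<in> {y \<in> s. y < vert s k}"
    then obtain i where i: "i \<in> {1..card s}" "y = vert s i"
      using bij_betw_imp_surj_on[OF bij_betw_vert[OF assms(1)]] by blast
    then show "y \<in> vert s ` {1..<k}"
      using y assms(2) strict_mono_on_less[OF mono i(1) assms(2)] by auto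
  next
    fix y assume "y \<in> vert s ` {1..<k}"
    then obtain i where "1 \<le> i" "i < k" "y = vert s i" by auto
    then show "y \<in> {y \<in> s. y < vert s k}"
      using assms vert_in[of s i] vert_less[of s i k] by simp
  qed
  moreover have "inj_on (vert s) {1..<k}"
    using strict_mono_on_imp_inj_on[OF mono] by (rule inj_on_subset) (use assms in auto)
  ultimately show ?thesis by (simp add: card_image)
qed

text \<open>Indexing the faces by the deleted vertex instead of its position turns the sign into the
  parity of the number of smaller vertices, a count that is additive over disjoint vertex sets.
  This is the form in which a simplex can be compared with its part in a link.\<close>

lemma alternating_face_sum:
  fixes \<phi> :: "'a::linorder set \<Rightarrow> 'f::field"
  assumes "finite s"
  shows "(\<Sum>k=1..card s. (-1)^(k+1) * \<phi> (face k s))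
       = (\<Sum>x\<in>s. (-1)^card {y \<in> s. y < x} * \<phi> (s - {x}))"
proof -
  let ?g = "\<lambda>x. (-1)^card {y \<in> s. y < x} * \<phi> (s - {x})"
  have "(\<Sum>k=1..card s. (-1)^(k+1) * \<phi> (face k s)) = (\<Sum>k=1..card s. ?g (vert s k))"
  proof (rule sum.cong[OF refl])
    fix k assume k: "k \<in> {1..card s}"
    then obtain j where "k = Suc j" by (cases k) auto
    then show "(-1)^(k+1) * \<phi> (face k s) = ?g (vert s k)"
      unfolding card_less_vert[OF assms k] face_def by simp
  qed
  also have "\<dots> = sum ?g s"
    by (rule sum.reindex_bij_betw[OF bij_betw_vert[OF assms]])
  finally show ?thesis .
qed

lemma simplices_finite: "simplicial_complex K \<Longrightarrow> s \<in> simplices n K \<Longrightarrow> finite s \<and> card s = n + 1"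
  by (auto simp: simplices_def simplicial_complex_def)

lemma simplex_subset:
  "simplicial_complex K \<Longrightarrow> s \<in> simplices n K \<Longrightarrow> t \<subseteq> s \<Longrightarrow> card t = m + 1 \<Longrightarrow> t \<in> simplices m K"
proof -
  assume *: "simplicial_complex K" "s \<in> simplices n K" "t \<subseteq> s" "card t = m + 1"
  then have "t \<noteq> {}" by auto
  then show ?thesis using * unfolding simplices_def simplicial_complex_def by blast
qed

lemma face_in_simplices:
  assumes "simplicial_complex K" "s \<in> simplices (n+1) K" "k \<in> {1..n+2}"
  shows "face k s \<in> simplices n K"
proof -
  have s: "finite s" "card s = n + 2" using simplices_finite[OF assms(1,2)] by auto
  then have "vert s k \<in> s" using assms(3) by (intro vert_in) auto
  then show ?thesis
    using s by (intro simplex_subset[OF assms(1,2)]) (auto simp: face_def)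
qed

lemma cobd_eq_sum_vertices:
  fixes \<phi> :: "'a::linorder set \<Rightarrow> 'f::field"
  assumes "finite s" "s \<in> simplices (n+1) K"
  shows "cobd n K \<phi> s = (\<Sum>x\<in>s. (-1)^card {y \<in> s. y < x} * \<phi> (s - {x}))"
  using alternating_face_sum[OF assms(1), of \<phi>] assms(2)
  by (simp add: cobd_def simplices_def)

lemma cobd_diff: "cobd n K (\<phi> - \<psi>) = cobd n K \<phi> - cobd n K (\<psi> :: 'a::linorder set \<Rightarrow> 'f::field)"
  by (rule ext) (simp add: cobd_def right_diff_distrib sum_subtractf sum_negf)

lemma coboundaries_zero: "0 \<in> coboundaries n K"
proof (cases n)
  case (Suc m)
  have "cobd m K (0 :: 'a set \<Rightarrow> 'b) = 0" by (rule ext) (simp add: cobd_def)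
  moreover have "0 \<in> cochains m K" by (simp add: cochains_def)
  ultimately show ?thesis unfolding coboundaries_def Suc nat.case by (metis imageI)
qed (simp add: coboundaries_def)

lemma coboundaries_diff:
  assumes "\<phi> \<in> coboundaries n K" "\<psi> \<in> coboundaries n K"
  shows "\<phi> - \<psi> \<in> coboundaries n K"
proof (cases n)
  case 0
  then show ?thesis using assms by (simp add: coboundaries_def)
next
  case (Suc m)
  then obtain a b where "a \<in> cochains m K" "b \<in> cochains m K" "\<phi> = cobd m K a" "\<psi> = cobd m K b"
    using assms by (auto simp: coboundaries_def)
  then have "\<phi> - \<psi> = cobd m K (a - b)" "a - b \<in> cochains m K"
    by (auto simp: cobd_diff cochains_def)
  then show ?thesis by (simp add: coboundaries_def Suc)
qed

lemma coboundaries_add: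
  assumes "\<phi> \<in> coboundaries n K" "\<psi> \<in> coboundaries n K"
  shows "\<phi> + \<psi> \<in> coboundaries n K"
  using coboundaries_diff[OF assms(1) coboundaries_diff[OF coboundaries_zero assms(2)]] by simp

lemma cohom_rel_class_eq:
  assumes "\<phi> \<in> cocycles n K" "\<psi> \<in> cocycles n K" "\<phi> - \<psi> \<in> coboundaries n K"
  shows "cohom_rel n K `` {\<phi>} = cohom_rel n K `` {\<psi>}"
proof -
  have "\<phi> - \<chi> \<in> coboundaries n K \<longleftrightarrow> \<psi> - \<chi> \<in> coboundaries n K" for \<chi>
  proof
    assume "\<phi> - \<chi> \<in> coboundaries n K"
    then have "(\<phi> - \<chi>) - (\<phi> - \<psi>) \<in> coboundaries n K" using assms(3) by (rule coboundaries_diff)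
    then show "\<psi> - \<chi> \<in> coboundaries n K" by simp
  next
    assume "\<psi> - \<chi> \<in> coboundaries n K"
    then have "(\<psi> - \<chi>) + (\<phi> - \<psi>) \<in> coboundaries n K" using assms(3) by (rule coboundaries_add)
    then show "\<phi> - \<chi> \<in> coboundaries n K" by simp
  qed
  then show ?thesis using assms by (auto simp: cohom_rel_def coset_rel_def)
qed

lemma cocycles_subset_coboundaries:
  assumes "(cohomology n K :: ('a::linorder set \<Rightarrow> 'f::field) set set) = {coboundaries n K}"
  shows "cocycles n K \<subseteq> (coboundaries n K :: ('a set \<Rightarrow> 'f) set)"
proof
  fix \<phi> :: "'a set \<Rightarrow> 'f" assume \<phi>: "\<phi> \<in> cocycles n K"
  then have "cohom_rel n K `` {\<phi>} \<in> cohomology n K"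
    unfolding cohomology_def by (rule quotientI)
  then have "cohom_rel n K `` {\<phi>} = coboundaries n K"
    using assms by simp
  moreover have "\<phi> \<in> cohom_rel n K `` {\<phi>}"
    using \<phi> coboundaries_zero by (auto simp: cohom_rel_def coset_rel_def)
  ultimately show "\<phi> \<in> coboundaries n K" by simp
qed

section \<open>Cochains supported on the star of a simplex\<close>

text \<open>For disjoint \<open>b\<close> and \<open>B\<close>, the sign of the permutation that sorts the vertices of \<open>B\<close>, in order,
  followed by those of \<open>b\<close>, also in order.\<close>

definition shuffle_sign :: "'a::linorder set \<Rightarrow> 'a set \<Rightarrow> 'f::field" where
  "shuffle_sign b B = (\<Prod>x\<in>B. (-1) ^ card {y \<in> b. y < x})"

lemma shuffle_sign_square: "shuffle_sign b B * shuffle_sign b B = (1::'f::field)"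
  by (simp add: shuffle_sign_def flip: prod.distrib power_add mult_2)

lemma shuffle_sign_cancel: "shuffle_sign b B * (shuffle_sign b B * a) = (a::'f::field)"
  unfolding mult.assoc[symmetric] shuffle_sign_square by simp

lemma simplices_link_iff:
  assumes "simplicial_complex K" "finite b" "B \<inter> b = {}"
  shows "B \<in> simplices m (link b K) \<longleftrightarrow> b \<union> B \<in> simplices (m + card b) K"
proof
  assume B: "B \<in> simplices m (link b K)"
  then have "card (b \<union> B) = card b + card B"
    using assms by (intro card_Un_disjoint) (auto simp: simplices_def intro: card_ge_0_finite)
  then show "b \<union> B \<in> simplices (m + card b) K"
    using B by (auto simp: simplices_def link_def)
next
  assume s: "b \<union> B \<in> simplices (m + card b) K"
  then have "finite (b \<union> B)" using simplices_finite[OF assms(1)] by blast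
  then have "card (b \<union> B) = card b + card B"
    using assms by (intro card_Un_disjoint) auto
  then have "card B = m + 1" using s by (simp add: simplices_def)
  moreover from this have "B \<in> simplices m K"
    by (intro simplex_subset[OF assms(1) s]) auto
  ultimately show "B \<in> simplices m (link b K)"
    using s assms(3) by (auto simp: simplices_def link_def)
qed

text \<open>The sign of the vertex \<open>x\<close> in \<open>b \<union> B\<close> is its sign in \<open>B\<close> times the parity of the number of
  vertices of \<open>b\<close> below \<open>x\<close>. The latter factor is exactly how \<open>shuffle_sign\<close> changes when \<open>x\<close> is
  removed from \<open>B\<close>.\<close>

lemma cobd_star:
  fixes g \<phi> :: "'a::linorder set \<Rightarrow> 'f::field"
  assumes K: "simplicial_complex K" and b: "finite b"
    and supp: "\<And>s. \<not> b \<subseteq> s \<Longrightarrow> g s = 0"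
    and g: "\<And>B. B \<in> simplices m (link b K) \<Longrightarrow> g (b \<union> B) = shuffle_sign b B * \<phi> B"
    and B: "B \<in> simplices (m + 1) (link b K)"
  shows "cobd (m + card b) K g (b \<union> B) = shuffle_sign b B * cobd m (link b K) \<phi> B"
proof -
  have disj: "B \<inter> b = {}" and s: "b \<union> B \<in> simplices (m + card b + 1) K"
    using B simplices_link_iff[OF K b, of B "m+1"] by (auto simp: simplices_def link_def)
  have fin: "finite B" using simplices_finite[OF K s] by auto
  have "(\<Sum>x\<in>b \<union> B. (-1)^card {y \<in> b \<union> B. y < x} * g (b \<union> B - {x}))
      = (\<Sum>x\<in>B. (-1)^card {y \<in> b \<union> B. y < x} * g (b \<union> B - {x}))"
    \<comment> \<open>Deleting a vertex of \<open>b\<close> leads out of the support of \<open>g\<close>.\<close>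
    using fin b disj by (intro sum.mono_neutral_right) (auto intro!: supp)
  also have "\<dots> = (\<Sum>x\<in>B. shuffle_sign b B * ((-1)^card {y \<in> B. y < x} * \<phi> (B - {x})))"
  proof (rule sum.cong[OF refl])
    fix x assume x: "x \<in> B"
    have "{y \<in> b \<union> B. y < x} = {y \<in> b. y < x} \<union> {y \<in> B. y < x}" by auto
    then have pos: "card {y \<in> b \<union> B. y < x} = card {y \<in> b. y < x} + card {y \<in> B. y < x}"
      using disj fin b by (auto intro: card_Un_disjoint)
    have sgn: "shuffle_sign b B = (-1) ^ card {y \<in> b. y < x} * (shuffle_sign b (B - {x}) :: 'f)"
      using x fin by (simp add: shuffle_sign_def prod.remove)
    have union: "b \<union> B - {x} = b \<union> (B - {x})" using x disj by auto
    have "card (b \<union> (B - {x})) = m + card b + 1"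
      using x s fin b disj simplices_finite[OF K s] by (simp flip: union)
    then have "b \<union> (B - {x}) \<in> simplices (m + card b) K"
      by (intro simplex_subset[OF K s]) auto
    then have "B - {x} \<in> simplices m (link b K)"
      using simplices_link_iff[OF K b, of "B - {x}" m] disj by auto
    then have "g (b \<union> B - {x}) = shuffle_sign b (B - {x}) * \<phi> (B - {x})"
      by (simp add: g union)
    then show "(-1)^card {y \<in> b \<union> B. y < x} * g (b \<union> B - {x})
        = shuffle_sign b B * ((-1)^card {y \<in> B. y < x} * \<phi> (B - {x}))"
      unfolding pos sgn by (simp add: power_add mult_ac)
  qed
  finally show ?thesis
    using fin b B s by (simp add: cobd_eq_sum_vertices sum_distrib_left)
qed

text \<open>Cochains of \<open>K\<close> supported on the star of \<open>b\<close> are the cochains of \<open>K\<close> relative to the complement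
  of the open star. By \<open>cobd_star\<close> they form a copy of the cochain complex of the link, shifted by
  \<open>card b\<close> and augmented by the empty simplex, which stands for \<open>b\<close> itself. The positive degree
  \<open>Suc m\<close> makes the primitives live on nonempty simplices of the link, out of reach of the
  augmentation.\<close>

lemma star_cocycle_is_coboundary:
  fixes g :: "'a::linorder set \<Rightarrow> 'f::field"
  assumes K: "simplicial_complex K" and b: "finite b"
    and acyclic: "cocycles (Suc m) (link b K)
      \<subseteq> (coboundaries (Suc m) (link b K) :: ('a set \<Rightarrow> 'f) set)"
    and g: "g \<in> cocycles (Suc m + card b) K"
    and supp: "\<And>s. \<not> b \<subseteq> s \<Longrightarrow> g s = 0"
  shows "g \<in> coboundaries (Suc m + card b) K"
proof -
  let ?L = "link b K"
  define \<phi> :: "'a set \<Rightarrow> 'f" where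
    "\<phi> B = (if B \<in> simplices (Suc m) ?L then shuffle_sign b B * g (b \<union> B) else 0)" for B
  have g\<phi>: "g (b \<union> B) = shuffle_sign b B * \<phi> B" if "B \<in> simplices (Suc m) ?L" for B
    using that by (simp add: \<phi>_def shuffle_sign_cancel)
  have "cobd (Suc m) ?L \<phi> B = 0" for B
  proof (cases "B \<in> simplices (Suc m + 1) ?L")
    case True
    have "shuffle_sign b B * cobd (Suc m) ?L \<phi> B = cobd (Suc m + card b) K g (b \<union> B)"
      by (rule cobd_star[OF K b supp g\<phi> True, symmetric])
    also have "\<dots> = 0" using g by (simp add: cocycles_def)
    finally have "shuffle_sign b B * (shuffle_sign b B * cobd (Suc m) ?L \<phi> B) = 0" by simp
    then show ?thesis by (simp only: shuffle_sign_cancel)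
  qed (simp add: cobd_def)
  then have "cobd (Suc m) ?L \<phi> = 0" by (intro ext) simp
  moreover have "\<phi> \<in> cochains (Suc m) ?L" by (simp add: cochains_def \<phi>_def)
  ultimately have "\<phi> \<in> cocycles (Suc m) ?L" by (simp add: cocycles_def)
  then have "\<phi> \<in> coboundaries (Suc m) ?L" using acyclic by (rule subsetD[rotated])
  then obtain \<eta> where \<eta>: "\<eta> \<in> cochains m ?L" "\<phi> = cobd m ?L \<eta>"
    unfolding coboundaries_def nat.case by (rule imageE)
  define h :: "'a set \<Rightarrow> 'f" where
    "h s = (if b \<subseteq> s then shuffle_sign b (s - b) * \<eta> (s - b) else 0)" for s
  have h\<eta>: "h (b \<union> B) = shuffle_sign b B * \<eta> B" if "B \<in> simplices m ?L" for B
  proof -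
    have "b \<union> B - b = B" using that by (auto simp: simplices_def link_def)
    then show ?thesis by (simp add: h_def)
  qed
  have h: "h \<in> cochains (m + card b) K"
    unfolding cochains_def
  proof (intro CollectI allI impI)
    fix s assume s: "s \<notin> simplices (m + card b) K"
    show "h s = 0"
    proof (cases "b \<subseteq> s")
      case True
      then have "b \<union> (s - b) = s" and "(s - b) \<inter> b = {}" by auto
      then have "s - b \<notin> simplices m ?L"
        using simplices_link_iff[OF K b, of "s - b" m] s by simp
      then show ?thesis using \<eta>(1) by (simp add: h_def cochains_def)
    qed (simp add: h_def)
  qed
  have "cobd (m + card b) K h s = g s" for s
  proof (cases "s \<in> simplices (m + card b + 1) K \<and> b \<subseteq> s")
    case True
    define B where "B = s - b"
    have s: "b \<union> B = s" and disj: "B \<inter> b = {}" using True by (auto simp: B_def)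
    have B: "B \<in> simplices (m + 1) ?L"
      using simplices_link_iff[OF K b disj, of "m + 1"] True by (simp add: s)
    have "cobd (m + card b) K h (b \<union> B) = shuffle_sign b B * cobd m ?L \<eta> B"
      by (rule cobd_star[OF K b _ h\<eta> B]) (simp add: h_def)
    also have "\<dots> = g (b \<union> B)" using g\<phi>[of B] B \<eta>(2) by simp
    finally show ?thesis by (simp only: s)
  next
    case False
    then consider "s \<notin> simplices (m + card b + 1) K" | "\<not> b \<subseteq> s" by auto
    then show ?thesis
    proof cases
      case 1
      then show ?thesis using g by (simp add: cobd_def cocycles_def cochains_def)
    next
      case 2
      then have "h (face k s) = 0" for k by (auto simp: h_def face_def)
      then show ?thesis using supp[OF 2] by (simp add: cobd_def)
    qed
  qed
  then have "g = cobd (m + card b) K h" by (intro ext) simp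
  then have "g \<in> cobd (m + card b) K ` cochains (m + card b) K" using h by (rule image_eqI)
  then show ?thesis by (simp add: coboundaries_def)
qed

section \<open>Evaluation of polynomials\<close>

lemma peval_superset:
  assumes "finite M" "Poly_Mapping.keys p \<subseteq> M"
  shows "peval v p = (\<Sum>m\<in>M. Poly_Mapping.lookup p m *
     (\<Prod>z\<in>Poly_Mapping.keys m. coord_val v z ^ Poly_Mapping.lookup m z))"
  unfolding peval_def psubst_def using assms
  by (intro sum.mono_neutral_left) (auto simp: in_keys_iff)

lemma peval_add: "peval v (p + q) = peval v p + peval v q"
proof -
  let ?M = "Poly_Mapping.keys p \<union> Poly_Mapping.keys q"
  show ?thesis
    using keys_add[of p q]
    by (subst (1 2 3) peval_superset[of ?M])
       (auto simp: lookup_add distrib_right sum.distrib)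
qed

lemma peval_zero: "peval v 0 = 0"
  by (simp add: peval_def psubst_def)

lemma peval_sum: "peval v (sum f A) = (\<Sum>i\<in>A. peval v (f i))"
  by (induction A rule: infinite_finite_induct) (auto simp: peval_add peval_zero)

lemma peval_single: "peval v (Poly_Mapping.single m a)
    = a * (\<Prod>z\<in>Poly_Mapping.keys m. coord_val v z ^ Poly_Mapping.lookup m z)"
  by (subst peval_superset[of "{m}"]) auto

lemma monomial_value_add:
  fixes m m' :: "coord \<Rightarrow>\<^sub>0 nat" and g :: "coord \<Rightarrow> 'f::field"
  shows "(\<Prod>z\<in>Poly_Mapping.keys (m + m'). g z ^ Poly_Mapping.lookup (m + m') z)
    = (\<Prod>z\<in>Poly_Mapping.keys m. g z ^ Poly_Mapping.lookup m z)
    * (\<Prod>z\<in>Poly_Mapping.keys m'. g z ^ Poly_Mapping.lookup m' z)"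
proof -
  let ?Z = "Poly_Mapping.keys m \<union> Poly_Mapping.keys m'"
  have eq: "(\<Prod>z\<in>Poly_Mapping.keys k. g z ^ Poly_Mapping.lookup k z)
      = (\<Prod>z\<in>?Z. g z ^ Poly_Mapping.lookup k z)"
    if "Poly_Mapping.keys k \<subseteq> ?Z" for k :: "coord \<Rightarrow>\<^sub>0 nat"
    using that by (intro prod.mono_neutral_left) (auto simp: in_keys_iff)
  show ?thesis
    unfolding eq[OF keys_add[of m m']] eq[of m, OF Un_upper1] eq[of m', OF Un_upper2]
    by (simp add: lookup_add power_add prod.distrib)
qed

lemma sum_monomials: "p = (\<Sum>m\<in>Poly_Mapping.keys p. Poly_Mapping.single m (Poly_Mapping.lookup p m))"
  by (rule poly_mapping_eqI)
    (auto simp: lookup_sum lookup_single when_def sum.delta in_keys_iff)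

lemma peval_mult: "peval v (p * q) = peval v p * peval v q"
proof -
  let ?s = "\<lambda>p m. Poly_Mapping.single m (Poly_Mapping.lookup p m)"
  have "peval v (p * q) = peval v ((\<Sum>m\<in>Poly_Mapping.keys p. ?s p m) * (\<Sum>m\<in>Poly_Mapping.keys q. ?s q m))"
    by (simp flip: sum_monomials)
  also have "\<dots> = (\<Sum>m\<in>Poly_Mapping.keys p. \<Sum>m'\<in>Poly_Mapping.keys q.
      peval v (?s p m) * peval v (?s q m'))"
    by (simp add: sum_product peval_sum mult_single peval_single monomial_value_add mult_ac)
  also have "\<dots> = peval v p * peval v q"
    by (simp flip: sum_product peval_sum sum_monomials)
  finally show ?thesis .
qed

lemma peval_one: "peval v 1 = 1"
  using peval_single[of v 0 1] by simp

lemma peval_const: "peval v (pconst a) = a"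
  by (simp add: pconst_def peval_single)

lemma peval_var: "peval v (pvar z) = coord_val v z"
  by (simp add: pvar_def peval_single)

lemma peval_power: "peval v (p ^ k) = peval v p ^ k"
  by (induction k) (auto simp: peval_one peval_mult)

lemma peval_prod: "peval v (prod f A) = (\<Prod>i\<in>A. peval v (f i))"
  by (induction A rule: infinite_finite_induct) (auto simp: peval_mult peval_one)

lemma peval_sign: "peval v ((-1) ^ k * p) = (-1) ^ k * peval v p"
proof -
  have "peval v (-1) = -1" using peval_add[of v 1 "-1"] by (simp add: peval_zero peval_one eq_neg_iff_add_eq_0 add.commute)
  then show ?thesis by (simp add: peval_mult peval_power)
qed

lemma peval_relabel:
  "peval v (psubst pconst (\<lambda>z. pvar (\<sigma> z)) c) = psubst (\<lambda>a. a) (\<lambda>z. coord_val v (\<sigma> z)) c"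
  by (simp add: psubst_def peval_sum peval_mult peval_prod peval_power peval_const peval_var)

text \<open>Cocycle conditions on hexagon cochains hold only modulo \<open>hex_ideal\<close>; evaluation at a permitted
  coloring makes them into equations in the field.\<close>

lemma peval_hex_ideal:
  assumes "p \<in> hex_ideal n" "v \<in> permitted (std_simplex n)"
  shows "peval v p = 0"
proof -
  obtain S q where "S \<subseteq> hex_linear n" and p: "p = (\<Sum>l\<in>S. q l * l)"
    using assms(1) by (auto simp: hex_ideal_def)
  then have "peval v l = 0" if "l \<in> S" for l
    using that assms(2) by (auto simp: hex_linear_def)
  then show ?thesis by (simp add: p peval_sum peval_mult)
qed

section \<open>Permitted colorings\<close>

lemma std_simplex_complex: "simplicial_complex (std_simplex n)"
proof -
  have "finite (std_simplex n)"
    by (rule finite_subset[of _ "Pow {1..n+1}"]) (auto simp: std_simplex_def)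
  then show ?thesis
    by (auto simp: simplicial_complex_def std_simplex_def intro: finite_subset)
qed

text \<open>Edge functionals and edge vectors depend only on the order of the vertices, so they are carried
  along by increasing maps. This serves two purposes: a coloring of a simplex can be transferred to
  the standard simplex, and identities on a pentachoron can be checked on the vertices 1 to 5.\<close>

lemma edge_image_eq_iff:
  assumes "strict_mono_on A f" "finite t" "card t = 4" "t \<subseteq> A" "b \<subseteq> A"
    and ij: "i \<in> {1..4}" "j \<in> {1..4}"
  shows "f ` b = {vert (f ` t) i, vert (f ` t) j} \<longleftrightarrow> b = {vert t i, vert t j}"
proof -
  have inj: "inj_on f A" using assms(1) by (rule strict_mono_on_imp_inj_on)
  have mono: "strict_mono_on t f" using assms by (auto simp: strict_mono_on_def)
  have "{vert t i, vert t j} \<subseteq> A"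
    using vert_in[OF assms(2)] assms by auto
  then show ?thesis
    using inj_on_image_eq_iff[OF inj assms(5), of "{vert t i, vert t j}"] ij
    by (simp add: vert_image[OF assms(2) mono] assms(3))
qed

lemma edge_contrib_image:
  assumes "strict_mono_on A f" "finite t" "card t = 4" "t \<subseteq> A" "b \<subseteq> A"
  shows "edge_contrib (f ` t) (f ` b) c = edge_contrib t b c"
  by (simp add: edge_contrib_def edge_image_eq_iff[OF assms] del: One_nat_def cong: if_cong)

lemma edge_color_image:
  assumes "strict_mono_on A f" "finite t" "card t = 4" "t \<subseteq> A" "b \<subseteq> A"
  shows "edge_color (f ` t) (f ` b) = (edge_color t b :: 'f::field \<times> 'f)"
  by (simp add: edge_color_def edge_image_eq_iff[OF assms] del: One_nat_def cong: if_cong)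

lemma face_card_finite:
  assumes "finite u" "card u = 5" "m \<in> {1..5}"
  shows "finite (face m u) \<and> card (face m u) = 4 \<and> face m u \<subseteq> u"
  using assms vert_in[of u m] by (auto simp: face_def)

lemma edge_functional_image:
  fixes v :: "('a::linorder, 'f::field) coloring"
  assumes "strict_mono_on u f" "finite u" "card u = 5" "b \<subseteq> u"
  shows "edge_functional (f ` u) (f ` b) v = edge_functional u b (\<lambda>t. v (f ` t))"
  unfolding edge_functional_def
proof (rule sum.cong[OF refl])
  fix m :: nat assume m: "m \<in> {1..5}"
  then show "(-1)^(m+1) * edge_contrib (face m (f ` u)) (f ` b) (v (face m (f ` u)))
      = (-1)^(m+1) * edge_contrib (face m u) b (v (f ` face m u))"
    using face_card_finite[OF assms(2,3) m] assms
    by (simp add: face_image edge_contrib_image[of u])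
qed

lemma edge_color_nonedge:
  assumes "finite t" "card t = 4" "\<not> b \<subseteq> t"
  shows "edge_color t b = (0 :: 'f::field \<times> 'f)"
proof -
  have "b \<noteq> {vert t i, vert t j}" if "i \<in> {1..4}" "j \<in> {1..4}" for i j
    using vert_in[of t i] vert_in[of t j] assms that by auto
  then show ?thesis by (simp add: edge_color_def zero_prod_def)
qed

lemma edge_functional_cong:
  assumes "\<And>m. m \<in> {1..5} \<Longrightarrow> v (face m u) = w (face m u)"
  shows "edge_functional u b v = edge_functional u b w"
  unfolding edge_functional_def using assms by (auto intro!: sum.cong)

lemma std_pentachoron_edges:
  assumes "b \<subseteq> {1..5::nat}" "card b = 2"
  shows "b \<in> {{1,2},{1,3},{1,4},{1,5},{2,3},{2,4},{2,5},{3,4},{3,5},{4,5}}"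
proof -
  obtain i j where ij: "b = {i, j}" "i \<noteq> j" using assms(2) by (meson card_2_iff)
  then have "i \<in> {1,2,3,4,5}" "j \<in> {1,2,3,4,5}" using assms(1) by auto
  then show ?thesis using ij by (elim insertE emptyE) (simp_all add: doubleton_eq_iff)
qed

lemma vert_quadruple:
  fixes p q r s :: "'a::linorder"
  assumes "p < q" "q < r" "r < s"
  shows "vert {p,q,r,s} 1 = p" "vert {p,q,r,s} 2 = q" "vert {p,q,r,s} 3 = r" "vert {p,q,r,s} 4 = s"
proof -
  have "sorted_list_of_set (set [p,q,r,s]) = [p,q,r,s]"
    using assms by (intro sorted_list_of_set.idem_if_sorted_distinct) auto
  then show "vert {p,q,r,s} 1 = p" "vert {p,q,r,s} 2 = q" "vert {p,q,r,s} 3 = r" "vert {p,q,r,s} 4 = s"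
    by (simp_all add: vert_def)
qed

lemma edge_functional_std:
  "edge_functional {1..5::nat} b v =
     edge_contrib {2,3,4,5} b (v {2,3,4,5}) - edge_contrib {1,3,4,5} b (v {1,3,4,5})
   + edge_contrib {1,2,4,5} b (v {1,2,4,5}) - edge_contrib {1,2,3,5} b (v {1,2,3,5})
   + edge_contrib {1,2,3,4} b (v {1,2,3,4})"
proof -
  have u: "{1..5::nat} = {1,2,3,4,5}" by auto
  have "sorted_list_of_set (set [1,2,3,4,5]) = [1,2,3,4,5::nat]"
    by (intro sorted_list_of_set.idem_if_sorted_distinct) auto
  then have "vert {1,2,3,4,5::nat} k = [1,2,3,4,5] ! (k - 1)" for k
    by (simp add: vert_def)
  then have "face 1 {1,2,3,4,5::nat} = {2,3,4,5}" "face 2 {1,2,3,4,5::nat} = {1,3,4,5}"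
    "face 3 {1,2,3,4,5::nat} = {1,2,4,5}" "face 4 {1,2,3,4,5::nat} = {1,2,3,5}"
    "face 5 {1,2,3,4,5::nat} = {1,2,3,4}"
    unfolding face_def by (simp_all add: insert_Diff_if)
  then show ?thesis by (simp add: edge_functional_def u del: One_nat_def)
qed

lemma edge_contrib_quadruple:
  fixes p q r s :: "'a::linorder"
  assumes "p < q" "q < r" "r < s"
  shows "edge_contrib {p,q,r,s} b c =
    (if b = {p,q} then snd c else if b = {p,r} then fst c - snd c else if b = {p,s} then - fst c
     else if b = {q,r} then - fst c else if b = {q,s} then fst c + snd c
     else if b = {r,s} then - snd c else 0)"
  unfolding edge_contrib_def vert_quadruple[OF assms] Let_def by (rule refl)

lemma edge_color_quadruple:
  fixes p q r s :: "'a::linorder"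
  assumes "p < q" "q < r" "r < s"
  shows "edge_color {p,q,r,s} b =
    (if b = {p,q} then (1, 0) else if b = {p,r} then (-1, 1) else if b = {p,s} then (0, -1)
     else if b = {q,r} then (0, -1) else if b = {q,s} then (1, 1)
     else if b = {r,s} then (-1, 0) else (0, 0))"
  unfolding edge_color_def vert_quadruple[OF assms] by (rule refl)

text \<open>A finite check: ten edge functionals applied to ten edge vectors.\<close>

lemma edge_functional_std_edge_color:
  assumes "b \<subseteq> {1..5::nat}" "card b = 2" "b' \<subseteq> {1..5::nat}" "card b' = 2"
  shows "edge_functional {1..5} b (\<lambda>t. edge_color t b') = (0::'f::field)"
proof -
  let ?E = "{{1,2},{1,3},{1,4},{1,5},{2,3},{2,4},{2,5},{3,4},{3,5},{4,5}} :: nat set set"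
  have all: "\<forall>b\<in>?E. \<forall>b'\<in>?E. edge_functional {1..5} b (\<lambda>t. edge_color t b') = (0::'f)"
    unfolding edge_functional_std
    by (simp add: edge_contrib_quadruple edge_color_quadruple doubleton_eq_iff
        del: One_nat_def)
  show ?thesis
    by (rule bspec[OF bspec[OF all std_pentachoron_edges[OF assms(1,2)]]
          std_pentachoron_edges[OF assms(3,4)]])
qed

definition color_scale :: "'f::field \<Rightarrow> 'f \<times> 'f \<Rightarrow> 'f \<times> 'f" where
  "color_scale a c = (a * fst c, a * snd c)"

lemma edge_contrib_linear:
  "edge_contrib t b (c + color_scale a d) = edge_contrib t b c + a * edge_contrib t b d"
  by (simp add: edge_contrib_def color_scale_def Let_def algebra_simps)

lemma edge_functional_linear:
  "edge_functional u b (\<lambda>t. v t + color_scale a (e t)) = edge_functional u b v + a * edge_functional u b e"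
  unfolding edge_functional_def edge_contrib_linear distrib_left sum.distrib sum_distrib_left
  by (simp add: mult_ac)

lemma edge_functional_edge_color:
  assumes "finite u" "card u = 5" "b \<subseteq> u" "card b = 2" "card b' = 2"
  shows "edge_functional u b (\<lambda>t. edge_color t b') = (0::'f::field)"
proof (cases "b' \<subseteq> u")
  case True
  let ?f = "vert u"
  have mono: "strict_mono_on {1..5} ?f" and u: "u = ?f ` {1..5}"
    using strict_mono_on_vert[OF assms(1)] bij_betw_imp_surj_on[OF bij_betw_vert[OF assms(1)]] assms(2)
    by simp_all
  have inj: "inj_on ?f {1..5}" using mono by (rule strict_mono_on_imp_inj_on)
  obtain c where c: "c \<subseteq> {1..5}" "b = ?f ` c" using assms(3) u by (metis subset_imageE)
  obtain c' where c': "c' \<subseteq> {1..5}" "b' = ?f ` c'" using True u by (metis subset_imageE)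
  have card5: "card {1..5::nat} = 5" by simp
  have card: "card c = 2" "card c' = 2"
    using card_image[OF inj_on_subset[OF inj c(1)]] card_image[OF inj_on_subset[OF inj c'(1)]]
      c c' assms by simp_all
  have "edge_functional u b (\<lambda>t. edge_color t b' :: 'f \<times> 'f)
      = edge_functional {1..5} c (\<lambda>t. edge_color (?f ` t) (?f ` c'))"
    using edge_functional_image[OF mono finite_atLeastAtMost card5 c(1), of "\<lambda>t. edge_color t b'"]
    by (simp only: u[symmetric] c(2)[symmetric] c'(2)[symmetric])
  also have "\<dots> = edge_functional {1..5} c (\<lambda>t. edge_color t c')"
  proof (rule edge_functional_cong)
    fix m :: nat assume "m \<in> {1..5}"
    then show "edge_color (?f ` face m {1..5}) (?f ` c') = (edge_color (face m {1..5}) c' :: 'f \<times> 'f)"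
      using face_card_finite[of "{1..5::nat}" m] by (intro edge_color_image[OF mono _ _ _ c'(1)]) auto
  qed
  also have "\<dots> = 0" by (rule edge_functional_std_edge_color[OF c(1) card(1) c'(1) card(2)])
  finally show ?thesis .
next
  case False
  have "edge_color (face m u) b' = (0 :: 'f \<times> 'f)" if "m \<in> {1..5}" for m
    using face_card_finite[OF assms(1,2) that] False by (intro edge_color_nonedge) auto
  then have "edge_functional u b (\<lambda>t. edge_color t b' :: 'f \<times> 'f) = edge_functional u b (\<lambda>t. 0)"
    by (rule edge_functional_cong)
  also have "\<dots> = 0" by (simp add: edge_functional_def edge_contrib_def cong: if_cong)
  finally show ?thesis .
qed

lemma edge_vector_permitted:
  assumes K: "simplicial_complex K" and "card b = 2"
  shows "(edge_vector K b :: ('a::linorder, 'f::field) coloring) \<in> permitted K"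
  unfolding permitted_def
proof (intro CollectI conjI ballI allI impI)
  show "(edge_vector K b :: ('a, 'f) coloring) \<in> colorings K" by (simp add: colorings_def edge_vector_def)
next
  fix u c assume u: "u \<in> simplices 4 K" and c: "c \<subseteq> u \<and> card c = 2"
  have fin: "finite u" "card u = 5" using simplices_finite[OF K u] by auto
  have "edge_vector K b (face m u) = (edge_color (face m u) b :: 'f \<times> 'f)" if "m \<in> {1..5}" for m
    using face_in_simplices[OF K, of u 3 m] u that by (simp add: edge_vector_def)
  then have "edge_functional u c (edge_vector K b) = edge_functional u c (\<lambda>t. edge_color t b :: 'f \<times> 'f)"
    by (rule edge_functional_cong)
  then show "edge_functional u c (edge_vector K b) = (0 :: 'f)"
    using edge_functional_edge_color[OF fin, of c b] c assms(2) by simp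
qed

lemma permitted_add_scale:
  assumes "v \<in> permitted K" "e \<in> permitted K"
  shows "(\<lambda>t. v t + color_scale a (e t)) \<in> permitted K"
  using assms by (simp add: permitted_def colorings_def edge_functional_linear)
    (simp add: color_scale_def zero_prod_def)

text \<open>This is what allows \<open>peval_hex_ideal\<close> to be applied to the colorings that occur in
  \<open>chain_map\<close>.\<close>

lemma transfer_coloring_permitted:
  fixes v :: "('a::linorder, 'f::field) coloring"
  assumes K: "simplicial_complex K" and s: "s \<in> simplices n K" and v: "v \<in> permitted K"
  shows "transfer_coloring n s v \<in> permitted (std_simplex n)"
  unfolding permitted_def
proof (intro CollectI conjI ballI allI impI)
  show "transfer_coloring n s v \<in> colorings (std_simplex n)"
    by (simp add: colorings_def transfer_coloring_def)
next
  fix u b assume u: "u \<in> simplices 4 (std_simplex n)" and b: "b \<subseteq> u \<and> card b = 2"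
  have fin: "finite s" "card s = n + 1" using simplices_finite[OF K s] by auto
  have ufin: "finite u" "card u = 5" using simplices_finite[OF std_simplex_complex u] by auto
  have sub: "u \<subseteq> {1..n+1}" using u by (auto simp: simplices_def std_simplex_def)
  have mono: "strict_mono_on u (vert s)"
    using sub fin by (intro strict_mono_on_vert_subset) simp_all
  have inj: "inj_on (vert s) u" using mono by (rule strict_mono_on_imp_inj_on)
  have "transfer_coloring n s v (face m u) = v (vert s ` face m u)" if "m \<in> {1..5}" for m
    using face_in_simplices[OF std_simplex_complex, of u 3 n m] u that
    by (simp add: transfer_coloring_def)
  then have "edge_functional u b (transfer_coloring n s v) = edge_functional u b (\<lambda>t. v (vert s ` t))"
    by (rule edge_functional_cong)
  also have "\<dots> = edge_functional (vert s ` u) (vert s ` b) v"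
    using b by (intro edge_functional_image[OF mono ufin, symmetric]) simp
  also have "\<dots> = 0"
  proof -
    have "vert s ` u \<subseteq> s" using vert_in[OF fin(1)] sub fin(2) by auto
    then have "vert s ` u \<in> simplices 4 K"
      by (rule simplex_subset[OF K s]) (simp add: card_image[OF inj] ufin)
    moreover have "vert s ` b \<subseteq> vert s ` u \<and> card (vert s ` b) = 2"
      using b card_image[OF inj_on_subset[OF inj]] by auto
    ultimately show ?thesis using v unfolding permitted_def by blast
  qed
  finally show "edge_functional u b (transfer_coloring n s v) = 0" .
qed

section \<open>Hexagon cocycles give simplicial cocycles\<close>

lemma hex_poly_eval_cong:
  assumes "c \<in> hex_poly n"
    and "\<And>z. coord_simplex z \<in> simplices 3 (std_simplex n) \<Longrightarrow> g z = g' z"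
  shows "psubst h g c = psubst h g' c"
proof -
  have "g z = g' z" if "m \<in> Poly_Mapping.keys c" "z \<in> Poly_Mapping.keys m" for m z
    using assms that by (auto simp: hex_poly_def)
  then show ?thesis unfolding psubst_def by (auto intro!: sum.cong prod.cong arg_cong2[where f="(*)"])
qed

text \<open>The \<open>k\<close>-th face of \<open>s\<close> is the image, under the numbering of \<open>s\<close>, of the \<open>k\<close>-th face of the
  standard simplex. So numbering the face directly is the same as numbering it inside the standard
  face and then inside \<open>s\<close>. Summed over \<open>k\<close>, this says that the chain map commutes with the
  coboundaries.\<close>

lemma chain_map_face:
  fixes v :: "('a::linorder, 'f::field) coloring"
  assumes K: "simplicial_complex K" and s: "s \<in> simplices (n+1) K" and k: "k \<in> {1..n+2}"
    and c: "c \<in> hex_poly n"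
  shows "chain_map n K v c (face k s) = peval (transfer_coloring (n+1) s v)
      (psubst pconst (\<lambda>z. pvar (coord_map (vert ({1..n+2} - {k})) z)) c)"
proof -
  let ?A = "{1..n+2} - {k}"
  have fin: "finite s" "card s = n + 2" using simplices_finite[OF K s] by auto
  have A: "finite ?A" "card ?A = n + 1" using k by auto
  have bij: "bij_betw (vert s) {1..n+2} s" using bij_betw_vert[OF fin(1)] fin(2) by simp
  have mono: "strict_mono_on ?A (vert s)"
    using fin by (intro strict_mono_on_vert_subset) auto
  have "face k s = vert s ` ?A"
    using bij k unfolding face_def bij_betw_def by (auto simp: inj_on_def)
  then have vert_face: "vert (face k s) j = vert s (vert ?A j)" if "j \<in> {1..n+1}" for j
    using vert_image[OF A(1) mono, of j] A(2) that by simp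
  have val: "coord_val (transfer_coloring n (face k s) v) z
      = coord_val (transfer_coloring (n+1) s v) (coord_map (vert ?A) z)"
    if z: "coord_simplex z \<in> simplices 3 (std_simplex n)" for z
  proof -
    define t where "t = coord_simplex z"
    have t: "t \<in> simplices 3 (std_simplex n)" using z by (simp add: t_def)
    then have sub: "t \<subseteq> {1..n+1}" and card: "card t = 4"
      by (auto simp: simplices_def std_simplex_def)
    have "vert (face k s) ` t = (\<lambda>j. vert s (vert ?A j)) ` t"
      using sub vert_face by (intro image_cong) auto
    then have img: "vert (face k s) ` t = vert s ` vert ?A ` t" by (simp add: image_image)
    have "inj_on (vert ?A) t"
      using bij_betw_vert[OF A(1)] A(2) sub by (metis bij_betw_imp_inj_on inj_on_subset)
    then have "card (vert ?A ` t) = 4" by (simp add: card_image card)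
    moreover have "vert ?A ` t \<subseteq> ?A" using vert_in[OF A(1)] A(2) sub by fastforce
    ultimately have "vert ?A ` t \<in> simplices 3 (std_simplex (n+1))"
      by (auto simp: simplices_def std_simplex_def)
    then have "transfer_coloring n (face k s) v t = transfer_coloring (n+1) s v (vert ?A ` t)"
      using t by (simp add: transfer_coloring_def img)
    then show ?thesis by (cases z) (simp_all add: t_def)
  qed
  have "chain_map n K v c (face k s) = peval (transfer_coloring n (face k s) v) c"
    using face_in_simplices[OF K s k] by (simp add: chain_map_def)
  also have "\<dots> = psubst (\<lambda>a. a) (\<lambda>z. coord_val (transfer_coloring (n+1) s v) (coord_map (vert ?A) z)) c"
    unfolding peval_def by (rule hex_poly_eval_cong[OF c val])
  finally show ?thesis by (simp only: peval_relabel)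
qed

lemma chain_map_cocycle:
  fixes v :: "('a::linorder, 'f::field) coloring"
  assumes K: "simplicial_complex K" and v: "v \<in> permitted K" and c: "c \<in> hex_cocycles n"
  shows "chain_map n K v c \<in> cocycles n K"
proof -
  have "cobd n K (chain_map n K v c) s = 0" for s
  proof (cases "s \<in> simplices (n+1) K")
    case s: True
    have "cobd n K (chain_map n K v c) s = (\<Sum>k=1..n+2. (-1)^(k+1) * chain_map n K v c (face k s))"
      using s by (simp add: cobd_def)
    also have "\<dots> = peval (transfer_coloring (n+1) s v) (hex_cobd n c)"
      unfolding hex_cobd_def peval_sum peval_sign
      using c by (intro sum.cong refl) (subst chain_map_face[OF K s], auto simp: hex_cocycles_def)
    also have "\<dots> = 0"
      using c transfer_coloring_permitted[OF K s v] by (intro peval_hex_ideal) (auto simp: hex_cocycles_def)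
    finally show ?thesis .
  qed (simp add: cobd_def)
  then have "cobd n K (chain_map n K v c) = 0" by (intro ext) simp
  then show ?thesis by (simp add: cocycles_def cochains_def chain_map_def)
qed

section \<open>Changing the coloring within its homology class\<close>

lemma chain_map_outside_star:
  fixes v :: "('a::linorder, 'f::field) coloring"
  assumes K: "simplicial_complex K" and b: "\<not> b \<subseteq> s"
  shows "chain_map n K (\<lambda>t. v t + color_scale a (edge_vector K b t)) c s = chain_map n K v c s"
proof (cases "s \<in> simplices n K")
  case s: True
  have fin: "finite s" "card s = n + 1" using simplices_finite[OF K s] by auto
  have "edge_vector K b (vert s ` t) = (0 :: 'f \<times> 'f)" if t: "t \<in> simplices 3 (std_simplex n)" for t
  proof -
    have sub: "t \<subseteq> {1..n+1}" using t by (auto simp: simplices_def std_simplex_def)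
    then have "vert s ` t \<subseteq> s" using vert_in[OF fin(1)] fin(2) by auto
    then have "\<not> b \<subseteq> vert s ` t" using b by blast
    moreover have "finite t'" "card t' = 4" if "t' \<in> simplices 3 K" for t'
      using simplices_finite[OF K that] by auto
    ultimately show ?thesis by (simp add: edge_vector_def edge_color_nonedge)
  qed
  then have "transfer_coloring n s (\<lambda>t. v t + color_scale a (edge_vector K b t)) = transfer_coloring n s v"
    by (intro ext) (simp add: transfer_coloring_def color_scale_def flip: zero_prod_def)
  then show ?thesis by (simp add: chain_map_def)
qed (simp add: chain_map_def)

lemma chain_map_add_edge_vector:
  fixes v :: "('a::linorder, 'f::field) coloring"
  assumes K: "simplicial_complex K" and n: "n \<ge> 3" and b: "b \<in> simplices 1 K"
    and acyclic: "cocycles (n - 2) (link b K) \<subseteq> (coboundaries (n - 2) (link b K) :: ('a set \<Rightarrow> 'f) set)"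
    and v: "v \<in> permitted K" and c: "c \<in> hex_cocycles n"
  shows "chain_map n K (\<lambda>t. v t + color_scale a (edge_vector K b t)) c - chain_map n K v c
    \<in> coboundaries n K"
proof -
  let ?w = "\<lambda>t. v t + color_scale a (edge_vector K b t)"
  let ?g = "chain_map n K ?w c - chain_map n K v c"
  have fin: "finite b" "card b = 2" using simplices_finite[OF K b] by auto
  have "?w \<in> permitted K"
    using v edge_vector_permitted[OF K fin(2)] by (rule permitted_add_scale)
  then have "chain_map n K ?w c \<in> cocycles n K" "chain_map n K v c \<in> cocycles n K"
    using chain_map_cocycle[OF K _ c] v by auto
  then have g: "?g \<in> cocycles n K" by (simp add: cocycles_def cochains_def cobd_diff)
  obtain m where m: "n - 2 = Suc m" using n by (cases "n - 2") auto
  then have n': "n = Suc m + card b" using fin by simp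
  have supp: "?g s = 0" if "\<not> b \<subseteq> s" for s
    using chain_map_outside_star[OF K that, of n v a c] by simp
  show ?thesis
    using star_cocycle_is_coboundary[OF K fin(1) acyclic[unfolded m] g[unfolded n'] supp[unfolded n']]
    unfolding n' .
qed

text \<open>Permittedness is carried along in the induction, since each step needs the chain map of the
  intermediate coloring to give cocycles.\<close>

lemma chain_map_add_edge_generated:
  fixes v :: "('a::linorder, 'f::field) coloring"
  assumes K: "simplicial_complex K" and n: "n \<ge> 3"
    and acyclic: "\<And>b. b \<in> simplices 1 K \<Longrightarrow>
      cocycles (n - 2) (link b K) \<subseteq> (coboundaries (n - 2) (link b K) :: ('a set \<Rightarrow> 'f) set)"
    and v: "v \<in> permitted K" and c: "c \<in> hex_cocycles n"
    and E: "finite E" "E \<subseteq> simplices 1 K"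
  shows "(\<lambda>t. v t + (\<Sum>b\<in>E. color_scale (a b) (edge_vector K b t))) \<in> permitted K \<and>
    chain_map n K (\<lambda>t. v t + (\<Sum>b\<in>E. color_scale (a b) (edge_vector K b t))) c - chain_map n K v c
      \<in> coboundaries n K"
  using E
proof (induction E rule: finite_induct)
  case empty
  then show ?case using v coboundaries_zero by (simp add: fun_diff_def flip: zero_fun_def)
next
  case (insert b E)
  let ?w = "\<lambda>t. v t + (\<Sum>b\<in>E. color_scale (a b) (edge_vector K b t))"
  let ?w' = "\<lambda>t. ?w t + color_scale (a b) (edge_vector K b t)"
  have b: "b \<in> simplices 1 K" using insert.prems by simp
  have "?w \<in> permitted K \<and> chain_map n K ?w c - chain_map n K v c \<in> coboundaries n K"
    using insert.prems by (intro insert.IH) simp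
  then have w: "?w \<in> permitted K" and IH: "chain_map n K ?w c - chain_map n K v c \<in> coboundaries n K"
    by (rule conjunct1, rule conjunct2)
  have "edge_vector K b \<in> permitted K"
    using simplices_finite[OF K b] by (intro edge_vector_permitted[OF K]) simp
  with w have perm: "?w' \<in> permitted K" by (rule permitted_add_scale)
  have "(chain_map n K ?w' c - chain_map n K ?w c) + (chain_map n K ?w c - chain_map n K v c)
      \<in> coboundaries n K"
    using chain_map_add_edge_vector[OF K n b acyclic[OF b] w c] IH by (rule coboundaries_add)
  then have diff: "chain_map n K ?w' c - chain_map n K v c \<in> coboundaries n K"
    by (simp only: add_diff_eq diff_add_cancel)
  have w': "?w' = (\<lambda>t. v t + (\<Sum>b\<in>insert b E. color_scale (a b) (edge_vector K b t)))"
    using insert by (simp add: add_ac)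
  show ?case using perm diff unfolding w' by (rule conjI)
qed

lemma chain_map_homologous:
  fixes v w :: "('a::linorder, 'f::field) coloring"
  assumes K: "simplicial_complex K" and n: "n \<ge> 3"
    and acyclic: "\<And>b. b \<in> simplices 1 K \<Longrightarrow>
      cocycles (n - 2) (link b K) \<subseteq> (coboundaries (n - 2) (link b K) :: ('a set \<Rightarrow> 'f) set)"
    and v: "v \<in> permitted K" and w: "w \<in> permitted K" and vw: "w - v \<in> edge_generated K"
    and c: "c \<in> hex_cocycles n"
  shows "cohom_rel n K `` {chain_map n K w c} = cohom_rel n K `` {chain_map n K v c}"
proof -
  obtain a where a: "w - v = (\<lambda>t. \<Sum>b\<in>simplices 1 K. color_scale (a b) (edge_vector K b t))"
    using vw by (auto simp: edge_generated_def color_scale_def)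
  then have "w = (\<lambda>t. v t + (\<Sum>b\<in>simplices 1 K. color_scale (a b) (edge_vector K b t)))"
    by (simp only: diff_eq_eq) (simp add: plus_fun_def add.commute)
  moreover have "finite (simplices 1 K)" using K by (simp add: simplices_def simplicial_complex_def)
  ultimately have "chain_map n K w c - chain_map n K v c \<in> coboundaries n K"
    using chain_map_add_edge_generated[OF K n acyclic v c, of "simplices 1 K" a] by simp
  then show ?thesis
    by (rule cohom_rel_class_eq[OF chain_map_cocycle[OF K w c] chain_map_cocycle[OF K v c]])
qed

theorem theorem3:
  fixes K :: "'a::linorder set set"
    and v w :: "('a, 'f::field) coloring"
    and n :: nat
  assumes "simplicial_complex K"
    and "n \<ge> 3"
    and "\<forall>b\<in>simplices 1 K.
           (cohomology (n - 2) (link b K) :: ('a set \<Rightarrow> 'f) set set)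
             = {coboundaries (n - 2) (link b K)}"
    and "X \<in> coloring_homology K" and "v \<in> X" and "w \<in> X"
  shows "\<forall>h\<in>hex_cohomology n. cohom_map n K v h = cohom_map n K w h"
proof
  fix h :: "'f cpoly set" assume h: "h \<in> hex_cohomology n"
  obtain z where X: "X = coset_rel (permitted K) (edge_generated K) `` {z}"
    using assms(4) unfolding coloring_homology_def by (rule quotientE)
  have perm: "z \<in> permitted K" "v \<in> permitted K" "w \<in> permitted K"
    and gen: "z - v \<in> edge_generated K" "z - w \<in> edge_generated K"
    using assms(5,6) by (auto simp: X coset_rel_def)
  have acyclic: "cocycles (n - 2) (link b K) \<subseteq> (coboundaries (n - 2) (link b K) :: ('a set \<Rightarrow> 'f) set)"
    if "b \<in> simplices 1 K" for b
    using assms(3) that by (intro cocycles_subset_coboundaries) blast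
  have "h \<subseteq> hex_cocycles n"
    using h by (auto simp: hex_cohomology_def quotient_def coset_rel_def)
  then have "cohom_rel n K `` {chain_map n K v c} = cohom_rel n K `` {chain_map n K w c}" if "c \<in> h" for c
    using chain_map_homologous[OF assms(1,2) acyclic perm(2,1) gen(1), of c]
      chain_map_homologous[OF assms(1,2) acyclic perm(3,1) gen(2), of c] that by blast
  then show "cohom_map n K v h = cohom_map n K w h" by (simp add: cohom_map_def)
qed

end
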